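(* Let $X,Y$ be nonempty sets, let $c:X\times Y\to\mathbb{R}$ be any function, suppose that $f:X\to(-\infty,+\infty]$ is a $c$-antiderivative of the mapping $M:X\rightrightarrows Y$, and let $\emptyset\neq S\subset\mathrm{dom}(M)$. Let $\mathcal{A}_{[c,f|_S,M]}$ be the set of all $c$-convex functions $h:X\to(-\infty,+\infty]$ with $G(M)\subset G(\partial_c h)$ and $h|_S=f|_S$, and let $\mathcal{A}_{[c,f^c|_{M(S)},M^{-1}]}$ be the set of all $c$-convex functions $k:Y\to(-\infty,+\infty]$ with $G(M^{-1})\subset G(\partial_c k)$ and $k|_{M(S)}=f^c|_{M(S)}$. Then: (1) $\mathcal{A}_{[c,f|_S,M]}$ is nonempty and contains both its upper envelope $\gamma_{[c,f|_S,M]}(x):=\sup\{h(x) : h\in\mathcal{A}_{[c,f|_S,M]}\}$ and its lower envelope $\alpha_{[c,f|_S,M]}(x):=\inf\{h(x) : h\in\mathcal{A}_{[c,f|_S,M]}\}$ ($x\in X$). (2) If $h:X\to(-\infty,+\infty]$ is any function (not necessarily $c$-convex) such that $G(M)\subset G(\partial_c h)$ and $h|_S=f|_S$, then $\alpha_{[c,f|_S,M]}\le h$ and $h^c\in\mathcal{A}_{[c,f^c|_{M(S)},M^{-1}]}$. (3) If $h:X\to(-\infty,+\infty]$ is $c$-convex, then $h\in\mathcal{A}_{[c,f|_S,M]}$ if and only if $h^c\in\mathcal{A}_{[c,f^c|_{M(S)},M^{-1}]}$. (4) Let $\gamma_{[c,f^c|_{M(S)},M^{-1}]}$ and $\alpha_{[c,f^c|_{M(S)},M^{-1}]}$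 denote the pointwise supremum and infimum, respectively, of the functions in $\mathcal{A}_{[c,f^c|_{M(S)},M^{-1}]}$. Then $$\big(\alpha_{[c,f|_S,M]}\big)^c=\gamma_{[c,f^c|_{M(S)},M^{-1}]}\quad\text{and}\quad \big(\gamma_{[c,f|_S,M]}\big)^c=\alpha_{[c,f^c|_{M(S)},M^{-1}]}.$$ (5) In the case $S=\mathrm{dom}(M)$, $$\gamma_{[c,f|_{\mathrm{dom}(M)},M]}=(f+\iota_{\mathrm{dom}(M)})^{cc},$$ and for all $x\in X$, $$\alpha_{[c,f|_{\mathrm{dom}(M)},M]}(x)=(f^c+\iota_{\mathrm{Im}(M)})^c(x)=\sup_{(s,t)\in G(M)}\big[f(s)+c(x,t)-c(s,t)\big].$$ Moreover, in this case, if $h:X\to(-\infty,+\infty]$ is $c$-convex, then $$h\in\mathcal{A}_{[c,f|_{\mathrm{dom}(M)},M]}\iff \alpha_{[c,f|_{\mathrm{dom}(M)},M]}\le h\le\gamma_{[c,f|_{\mathrm{dom}(M)},M]}.$$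
   Context: A function $f:X\to(-\infty,+\infty]$ is proper if $\mathrm{dom}(f)=\{x: f(x)<\infty\}\ne\emptyset$. The $c$-transform of $f:X\to[-\infty,\infty]$ is $f^c:Y\to[-\infty,\infty]$, $f^c(y)=\sup_{x\in X}[c(x,y)-f(x)]$; the $c$-transform of $g:Y\to[-\infty,\infty]$ is $g^c:X\to[-\infty,\infty]$, $g^c(x)=\sup_{y\in Y}[c(x,y)-g(y)]$; $f^{cc}:=(f^c)^c$. A proper function $f:X\to(-\infty,+\infty]$ is $c$-convex if $f=g^c$ for some $g:Y\to(-\infty,+\infty]$; symmetrically, a proper function $k:Y\to(-\infty,+\infty]$ is $c$-convex if $k=f^c$ for some $f:X\to(-\infty,+\infty]$. For a multivalued mapping $M:X\rightrightarrows Y$: $G(M)=\{(x,y): y\in M(x)\}$, $\mathrm{dom}(M)=\{x: M(x)\neq\emptyset\}$, $M(S)=\bigcup_{s\in S}M(s)$, $\mathrm{Im}(M)=M(X)$, and $M^{-1}:Y\rightrightarrows X$ is given by $x\in M^{-1}(y)\iff y\in M(x)$. For a proper $f:X\to(-\infty,+\infty]$, the $c$-subdifferential $\partial_c f:X\rightrightarrows Y$ is $\partial_c f(x)=\{y\in Y: f(x)+c(x',y)\le f(x')+c(x,y)\ \forall x'\in X\}$ (equivalently, $f(x)+f^c(y)=c(x,y)$). Symmetrically, for a proper $k:Y\to(-\infty,+\infty]$, $\partial_c k:Y\rightrightarrows X$ is $\partial_c k(y)=\{x\in X: k(y)+c(x,y')\le k(y')+c(x,y)\ \forall y'\in Y\}$.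 A proper function $f$ is a $c$-antiderivative of $M$ if $G(M)\subset G(\partial_c f)$. Writing $G(M)\subset G(\partial_c h)$ presupposes that $h$ is proper. $\iota_A$ denotes the indicator function of a set $A$: $0$ on $A$ and $+\infty$ off $A$. *)

theory Defs
  imports "HOL-Library.Extended_Real"
begin

text \<open>
  The nonempty sets \<open>X\<close> and \<open>Y\<close> are the type variables \<open>'a\<close> and \<open>'b\<close>. Functions into
  \<open>(-\<infinity>, +\<infinity>]\<close> are \<open>ereal\<close>-valued functions avoiding \<open>-\<infinity>\<close>. Every notion is stated for
  functions on the first argument of the cost; its counterpart for functions on \<open>Y\<close> is
  the same notion for the swapped cost \<open>swap_cost c\<close>.
\<close>

abbreviation (input) swap_cost :: "('a \<Rightarrow> 'b \<Rightarrow> real) \<Rightarrow> 'b \<Rightarrow> 'a \<Rightarrow> real" where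
  "swap_cost c \<equiv> (\<lambda>y x. c x y)"

definition no_minf :: "('a \<Rightarrow> ereal) \<Rightarrow> bool" where
  "no_minf f \<longleftrightarrow> (\<forall>x. f x \<noteq> - \<infinity>)"

definition proper :: "('a \<Rightarrow> ereal) \<Rightarrow> bool" where
  "proper f \<longleftrightarrow> no_minf f \<and> {x. f x < \<infinity>} \<noteq> {}"

text \<open>Since \<open>c\<close> is real-valued, the difference is never of the form \<open>\<infinity> - \<infinity>\<close>.\<close>

definition ctrans :: "('a \<Rightarrow> 'b \<Rightarrow> real) \<Rightarrow> ('a \<Rightarrow> ereal) \<Rightarrow> 'b \<Rightarrow> ereal" where
  "ctrans c f y = (SUP x. ereal (c x y) - f x)"

definition cconvex :: "('a \<Rightarrow> 'b \<Rightarrow> real) \<Rightarrow> ('a \<Rightarrow> ereal) \<Rightarrow> bool" where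
  "cconvex c f \<longleftrightarrow> proper f \<and> (\<exists>g. no_minf g \<and> f = ctrans (swap_cost c) g)"

definition graph :: "('a \<Rightarrow> 'b set) \<Rightarrow> ('a \<times> 'b) set" where
  "graph M = {(x, y). y \<in> M x}"

definition mdom :: "('a \<Rightarrow> 'b set) \<Rightarrow> 'a set" where
  "mdom M = {x. M x \<noteq> {}}"

definition mimage :: "('a \<Rightarrow> 'b set) \<Rightarrow> 'a set \<Rightarrow> 'b set" where
  "mimage M S = (\<Union>s\<in>S. M s)"

definition minv :: "('a \<Rightarrow> 'b set) \<Rightarrow> 'b \<Rightarrow> 'a set" where
  "minv M y = {x. y \<in> M x}"

text \<open>Only meaningful for proper \<open>f\<close>; properness is required in \<open>cantideriv\<close> below.\<close>

definition csubdiff :: "('a \<Rightarrow> 'b \<Rightarrow> real) \<Rightarrow> ('a \<Rightarrow> ereal) \<Rightarrow> 'a \<Rightarrow> 'b set" where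
  "csubdiff c f x = {y. \<forall>x'. f x + ereal (c x' y) \<le> f x' + ereal (c x y)}"

definition cantideriv ::
  "('a \<Rightarrow> 'b \<Rightarrow> real) \<Rightarrow> ('a \<Rightarrow> 'b set) \<Rightarrow> ('a \<Rightarrow> ereal) \<Rightarrow> bool" where
  "cantideriv c M f \<longleftrightarrow> proper f \<and> graph M \<subseteq> graph (csubdiff c f)"

text \<open>The family \<open>\<A>\<close> with index \<open>[c, f|S, M]\<close>, and its upper and lower envelopes.\<close>

definition antiderivs ::
  "('a \<Rightarrow> 'b \<Rightarrow> real) \<Rightarrow> ('a \<Rightarrow> ereal) \<Rightarrow> 'a set \<Rightarrow> ('a \<Rightarrow> 'b set) \<Rightarrow> ('a \<Rightarrow> ereal) set" where
  "antiderivs c f S M = {h. cconvex c h \<and> cantideriv c M h \<and> (\<forall>x\<in>S. h x = f x)}"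

definition upper_env ::
  "('a \<Rightarrow> 'b \<Rightarrow> real) \<Rightarrow> ('a \<Rightarrow> ereal) \<Rightarrow> 'a set \<Rightarrow> ('a \<Rightarrow> 'b set) \<Rightarrow> 'a \<Rightarrow> ereal" where
  "upper_env c f S M x = (SUP h\<in>antiderivs c f S M. h x)"

definition lower_env ::
  "('a \<Rightarrow> 'b \<Rightarrow> real) \<Rightarrow> ('a \<Rightarrow> ereal) \<Rightarrow> 'a set \<Rightarrow> ('a \<Rightarrow> 'b set) \<Rightarrow> 'a \<Rightarrow> ereal" where
  "lower_env c f S M x = (INF h\<in>antiderivs c f S M. h x)"

text \<open>Indicator function in the sense of convex analysis.\<close>

definition iota :: "'a set \<Rightarrow> 'a \<Rightarrow> ereal" where
  "iota A x = (if x \<in> A then 0 else \<infinity>)"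

end

theory Submission
  imports Defs
begin

text \<open>
  Everything rests on two facts. First, the transforms \<open>f \<mapsto> f\<^sup>c\<close> and \<open>g \<mapsto> g\<^sup>c\<close> form an antitone
  Galois connection; hence \<open>f\<^sup>c\<^sup>c \<le> f\<close>, \<open>f\<^sup>c\<^sup>c\<^sup>c = f\<^sup>c\<close>, and the \<open>c\<close>-convex functions are fixed by
  the double transform. Second, \<open>f\<close> is a \<open>c\<close>-antiderivative of \<open>M\<close> iff it is proper and
  \<open>f x + f\<^sup>c y = c x y\<close> on the graph of \<open>M\<close> (\<open>cantideriv_iff\<close>). This equality is symmetric in
  the two variables, so \<open>f\<^sup>c\<close> is an antiderivative of the inverse of \<open>M\<close>
  (\<open>cantideriv_ctrans\<close>), and it shows that the values of \<open>f\<close> on \<open>S\<close> and those of \<open>f\<^sup>c\<close> on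
  \<open>M(S)\<close> determine each other. Thus the \<open>c\<close>-transform is an order-reversing bijection between
  the two families of antiderivatives (\<open>ctrans_mem_antiderivs\<close>, \<open>mem_antiderivs_if_ctrans_mem\<close>), and
  it swaps their envelopes.

  The double transform sends any antiderivative to a \<open>c\<close>-convex one lying below it and
  agreeing with it on the domain of \<open>M\<close>. So the family is nonempty. Its lower
  envelope \<open>\<alpha>\<close> is a proper antiderivative because the defining inequalities survive infima; as
  \<open>\<alpha>\<^sup>c\<^sup>c\<close> then belongs to the family, \<open>\<alpha> \<le> \<alpha>\<^sup>c\<^sup>c \<le> \<alpha>\<close> and \<open>\<alpha>\<close> is \<open>c\<close>-convex.
  The upper envelope is an antiderivative because the inequalities survive suprema, and it is
  \<open>c\<close>-convex because \<open>c\<close>-convexity does.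

  When \<open>S\<close> is the whole domain of \<open>M\<close>, the function \<open>f + \<iota>\<close> is the largest antiderivative that agrees
  with \<open>f\<close> on \<open>S\<close>, so its double transform is the upper envelope. The formula for the lower
  envelope is this result for the inverse mapping, transported back by the transform.
\<close>

section \<open>The c-transform as a Galois connection\<close>

lemma ereal_minus_le_swap: "ereal a - u \<le> v \<longleftrightarrow> ereal a - v \<le> u"
  by (cases u; cases v) auto

lemma ctrans_upper: "ereal (c x y) - f x \<le> ctrans c f y"
  unfolding ctrans_def by (rule SUP_upper) simp

lemma ctrans_le_iff: "ctrans c f y \<le> r \<longleftrightarrow> (\<forall>x. ereal (c x y) - f x \<le> r)"
  unfolding ctrans_def by (auto simp: SUP_le_iff)

lemma ctrans_galois: "ctrans c f \<le> g \<longleftrightarrow> ctrans (swap_cost c) g \<le> f"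
  unfolding le_fun_def ctrans_le_iff using ereal_minus_le_swap by metis

lemma ctrans_ctrans_le: "ctrans (swap_cost c) (ctrans c f) \<le> f"
  using ctrans_galois by blast

lemma ctrans_antimono: "f \<le> g \<Longrightarrow> ctrans c g \<le> ctrans c f"
  using ctrans_galois[of c g] ctrans_ctrans_le[of c f] order_trans by blast

lemma ctrans_triple: "ctrans c (ctrans (swap_cost c) (ctrans c f)) = ctrans c f"
  by (rule antisym[OF ctrans_ctrans_le ctrans_antimono[OF ctrans_ctrans_le]])

lemma cconvex_bitransform:
  assumes "cconvex c h" shows "ctrans (swap_cost c) (ctrans c h) = h"
  using assms ctrans_triple[of "swap_cost c"] unfolding cconvex_def by metis

section \<open>Antiderivatives and the equality case of the Fenchel inequality\<close>

lemma no_minf_ctrans: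
  assumes "proper f" shows "no_minf (ctrans c f)"
proof -
  obtain x where x: "f x < \<infinity>" "f x \<noteq> -\<infinity>"
    using assms unfolding proper_def no_minf_def by auto
  then have "ctrans c f y \<noteq> -\<infinity>" for y
    using ctrans_upper[of c x y f] by (cases "f x") auto
  then show ?thesis unfolding no_minf_def by blast
qed

lemma mem_csubdiff_iff:
  assumes "proper f"
  shows "y \<in> csubdiff c f x \<longleftrightarrow> f x + ctrans c f y = ereal (c x y)"
proof
  assume y: "y \<in> csubdiff c f x"
  obtain z where z: "f z < \<infinity>" "f z \<noteq> -\<infinity>"
    using assms unfolding proper_def no_minf_def by auto
  \<comment> \<open>The subgradient inequality at a point of finiteness of \<open>f\<close> makes \<open>f x\<close> finite.\<close>
  have "f x + ereal (c z y) \<le> f z + ereal (c x y)"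
    using y unfolding csubdiff_def by blast
  moreover have "f x \<noteq> -\<infinity>" using assms unfolding proper_def no_minf_def by blast
  ultimately obtain r where r: "f x = ereal r"
    using z by (cases "f x"; cases "f z") auto
  have "ereal (c x' y) - f x' \<le> ereal (c x y - r)" for x'
  proof -
    have "f x + ereal (c x' y) \<le> f x' + ereal (c x y)"
      using y unfolding csubdiff_def by blast
    then show ?thesis using r by (cases "f x'") auto
  qed
  then have "ctrans c f y \<le> ereal (c x y - r)" by (simp add: ctrans_le_iff)
  moreover have "ereal (c x y - r) \<le> ctrans c f y"
    using ctrans_upper[of c x y f] r by simp
  ultimately have "ctrans c f y = ereal (c x y - r)" by (rule antisym)
  then show "f x + ctrans c f y = ereal (c x y)" using r by simp
next
  assume eq: "f x + ctrans c f y = ereal (c x y)"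
  then obtain r q where rq: "f x = ereal r" "ctrans c f y = ereal q" "r + q = c x y"
    by (cases "f x"; cases "ctrans c f y") auto
  have "f x + ereal (c x' y) \<le> f x' + ereal (c x y)" for x'
    using ctrans_upper[of c x' y f] rq by (cases "f x'") auto
  then show "y \<in> csubdiff c f x" unfolding csubdiff_def by blast
qed

lemma cantideriv_iff:
  "cantideriv c M f \<longleftrightarrow>
     proper f \<and> (\<forall>x. \<forall>y\<in>M x. f x + ctrans c f y = ereal (c x y))"
proof (cases "proper f")
  case True
  then show ?thesis
    by (auto simp: cantideriv_def graph_def subset_iff mem_csubdiff_iff)
qed (simp add: cantideriv_def)

lemma cantideriv_ineq:
  assumes "cantideriv c M f" and "y \<in> M x"
  shows "f x + ereal (c x' y) \<le> f x' + ereal (c x y)"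
  using assms unfolding cantideriv_def graph_def csubdiff_def by auto

lemma cantiderivI:
  assumes "proper f"
    and "\<And>x y x'. y \<in> M x \<Longrightarrow> f x + ereal (c x' y) \<le> f x' + ereal (c x y)"
  shows "cantideriv c M f"
  using assms unfolding cantideriv_def graph_def csubdiff_def by auto

lemma cantideriv_finite:
  assumes "cantideriv c M f" and "y \<in> M x"
  obtains r where "f x = ereal r" and "ctrans c f y = ereal (c x y - r)"
proof -
  have "f x + ctrans c f y = ereal (c x y)" using assms cantideriv_iff by metis
  then show ?thesis using that by (cases "f x"; cases "ctrans c f y") auto
qed

lemma cantideriv_bitransform_eq:
  assumes "cantideriv c M f" and "x \<in> mdom M"
  shows "ctrans (swap_cost c) (ctrans c f) x = f x"
proof (rule antisym)
  show "ctrans (swap_cost c) (ctrans c f) x \<le> f x"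
    using ctrans_ctrans_le by (rule le_funD)
  obtain y where y: "y \<in> M x" using assms(2) unfolding mdom_def by blast
  obtain r where "f x = ereal r" "ctrans c f y = ereal (c x y - r)"
    using cantideriv_finite[OF assms(1) y] .
  then show "f x \<le> ctrans (swap_cost c) (ctrans c f) x"
    using ctrans_upper[of "swap_cost c" y x "ctrans c f"] by simp
qed

lemma proper_ctrans:
  assumes "cantideriv c M f" and "mdom M \<noteq> {}"
  shows "proper (ctrans c f)"
proof -
  obtain x y where y: "y \<in> M x" using assms(2) unfolding mdom_def by blast
  obtain r where "f x = ereal r" "ctrans c f y = ereal (c x y - r)"
    using cantideriv_finite[OF assms(1) y] .
  then have "ctrans c f y < \<infinity>" by simp
  moreover have "no_minf (ctrans c f)"
    using assms(1) no_minf_ctrans unfolding cantideriv_def by blast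
  ultimately show ?thesis unfolding proper_def by blast
qed

lemma cconvex_ctrans:
  assumes "cantideriv c M f" and "mdom M \<noteq> {}"
  shows "cconvex (swap_cost c) (ctrans c f)"
  using assms proper_ctrans unfolding cconvex_def cantideriv_def proper_def by blast

lemma minv_minv: "minv (minv M) = M"
  unfolding minv_def by auto

lemma mdom_minv: "mdom (minv M) = mimage M UNIV"
  unfolding mdom_def minv_def mimage_def by auto

lemma mimage_mdom: "mimage M (mdom M) = mimage M UNIV"
  unfolding mdom_def mimage_def by auto

lemma mimage_ne:
  assumes "S \<noteq> {}" and "S \<subseteq> mdom M" shows "mimage M S \<noteq> {}"
  using assms unfolding mdom_def mimage_def by blast

lemma mimage_subset_mdom_minv: "mimage M S \<subseteq> mdom (minv M)"
  unfolding mdom_minv mimage_def by blast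

lemma subset_mimage_minv:
  assumes "S \<subseteq> mdom M" shows "S \<subseteq> mimage (minv M) (mimage M S)"
  using assms unfolding mdom_def minv_def mimage_def by blast

text \<open>The equality \<open>f x + f\<^sup>c y = c x y\<close> remains valid with \<open>f\<^sup>c\<^sup>c\<close> in place of \<open>f\<close>, because both
  agree on the domain of \<open>M\<close>; read in the variable \<open>y\<close>, it is the claim.\<close>

lemma cantideriv_ctrans:
  assumes "cantideriv c M f" and "mdom M \<noteq> {}"
  shows "cantideriv (swap_cost c) (minv M) (ctrans c f)"
proof -
  have "ctrans c f y + ctrans (swap_cost c) (ctrans c f) x = ereal (c x y)"
    if "x \<in> minv M y" for x y
  proof -
    have y: "y \<in> M x" using that unfolding minv_def by simp
    then have "x \<in> mdom M" unfolding mdom_def by blast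
    then show ?thesis
      using cantideriv_bitransform_eq[OF assms(1)] assms(1) y
      by (simp add: cantideriv_iff add.commute)
  qed
  then show ?thesis using proper_ctrans[OF assms] by (simp add: cantideriv_iff)
qed

section \<open>Transforming a family of antiderivatives\<close>

text \<open>For \<open>t \<in> M s\<close> with \<open>s \<in> S\<close>, both \<open>h\<^sup>c t\<close> and \<open>f\<^sup>c t\<close> equal \<open>c s t - f s\<close>.\<close>

lemma ctrans_mem_antiderivs:
  assumes "cantideriv c M f" and "S \<noteq> {}" and "S \<subseteq> mdom M"
    and h: "cantideriv c M h" "\<forall>x\<in>S. h x = f x"
  shows "ctrans c h \<in> antiderivs (swap_cost c) (ctrans c f) (mimage M S) (minv M)"
proof -
  have ne: "mdom M \<noteq> {}" using assms(2,3) by blast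
  have "ctrans c h t = ctrans c f t" if t: "t \<in> mimage M S" for t
  proof -
    obtain s where s: "s \<in> S" "t \<in> M s" using t unfolding mimage_def by blast
    obtain r where "f s = ereal r" "ctrans c f t = ereal (c s t - r)"
      using cantideriv_finite[OF assms(1) s(2)] .
    moreover obtain q where "h s = ereal q" "ctrans c h t = ereal (c s t - q)"
      using cantideriv_finite[OF h(1) s(2)] .
    ultimately show ?thesis using h(2) s(1) by auto
  qed
  then show ?thesis
    using cconvex_ctrans[OF h(1) ne] cantideriv_ctrans[OF h(1) ne]
    unfolding antiderivs_def by blast
qed

text \<open>This is the preceding lemma for the swapped cost and the inverse mapping. It returns to the
  given family because \<open>f\<^sup>c\<^sup>c = f\<close> on the domain of \<open>M\<close> and \<open>S \<subseteq> M\<^sup>-\<^sup>1(M(S))\<close>.\<close>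

lemma ctrans_mem_antiderivs_back:
  assumes "cantideriv c M f" and "S \<noteq> {}" and "S \<subseteq> mdom M"
    and k: "k \<in> antiderivs (swap_cost c) (ctrans c f) (mimage M S) (minv M)"
  shows "ctrans (swap_cost c) k \<in> antiderivs c f S M"
proof -
  have ne: "mdom M \<noteq> {}" using assms(2,3) by blast
  have "ctrans (swap_cost c) k
      \<in> antiderivs c (ctrans (swap_cost c) (ctrans c f)) (mimage (minv M) (mimage M S)) M"
    using ctrans_mem_antiderivs[OF cantideriv_ctrans[OF assms(1) ne]
        mimage_ne[OF assms(2,3)] mimage_subset_mdom_minv, of k] k
    by (simp add: antiderivs_def minv_minv)
  moreover have "ctrans (swap_cost c) (ctrans c f) x = f x" if "x \<in> S" for x
    using cantideriv_bitransform_eq[OF assms(1)] assms(3) that by blast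
  ultimately show ?thesis
    using subset_mimage_minv[OF assms(3)] unfolding antiderivs_def by auto
qed

lemma bitransform_mem_antiderivs:
  assumes "cantideriv c M f" and "S \<noteq> {}" and "S \<subseteq> mdom M"
    and "cantideriv c M h" "\<forall>x\<in>S. h x = f x"
  shows "ctrans (swap_cost c) (ctrans c h) \<in> antiderivs c f S M"
  using ctrans_mem_antiderivs_back[OF assms(1-3)] ctrans_mem_antiderivs[OF assms] by blast

lemma mem_antiderivs_if_ctrans_mem:
  assumes "cantideriv c M f" and "S \<noteq> {}" and "S \<subseteq> mdom M" and "cconvex c h"
    and "ctrans c h \<in> antiderivs (swap_cost c) (ctrans c f) (mimage M S) (minv M)"
  shows "h \<in> antiderivs c f S M"
  using ctrans_mem_antiderivs_back[OF assms(1-3,5)] cconvex_bitransform[OF assms(4)] by simp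

section \<open>The envelopes belong to the family\<close>

lemma lower_env_le: "h \<in> antiderivs c f S M \<Longrightarrow> lower_env c f S M \<le> h"
  unfolding lower_env_def le_fun_def by (auto intro: INF_lower)

lemma upper_env_ge: "h \<in> antiderivs c f S M \<Longrightarrow> h \<le> upper_env c f S M"
  unfolding upper_env_def le_fun_def by (auto intro: SUP_upper)

lemma antiderivs_nonempty:
  assumes "cantideriv c M f" and "S \<noteq> {}" and "S \<subseteq> mdom M"
  shows "antiderivs c f S M \<noteq> {}"
  using bitransform_mem_antiderivs[OF assms assms(1)] by blast

lemma lower_env_eq_on:
  assumes "antiderivs c f S M \<noteq> {}" and "x \<in> S"
  shows "lower_env c f S M x = f x"
proof -
  have "(INF h\<in>antiderivs c f S M. h x) = (INF h\<in>antiderivs c f S M. f x)"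
    using assms(2) by (intro INF_cong) (auto simp: antiderivs_def)
  then show ?thesis using assms(1) by (simp add: lower_env_def)
qed

lemma upper_env_eq_on:
  assumes "antiderivs c f S M \<noteq> {}" and "x \<in> S"
  shows "upper_env c f S M x = f x"
proof -
  have "(SUP h\<in>antiderivs c f S M. h x) = (SUP h\<in>antiderivs c f S M. f x)"
    using assms(2) by (intro SUP_cong) (auto simp: antiderivs_def)
  then show ?thesis using assms(1) by (simp add: upper_env_def)
qed

lemma lower_env_le_antideriv:
  assumes "cantideriv c M f" and "S \<noteq> {}" and "S \<subseteq> mdom M"
    and "cantideriv c M h" "\<forall>x\<in>S. h x = f x"
  shows "lower_env c f S M \<le> h"
  using lower_env_le[OF bitransform_mem_antiderivs[OF assms]] ctrans_ctrans_le order_trans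
  by blast

lemma lower_env_mem:
  assumes "cantideriv c M f" and "S \<noteq> {}" and "S \<subseteq> mdom M"
  shows "lower_env c f S M \<in> antiderivs c f S M"
proof -
  let ?A = "antiderivs c f S M" and ?a = "lower_env c f S M"
  have ne: "?A \<noteq> {}" using antiderivs_nonempty[OF assms] .
  obtain s t where s: "s \<in> S" and t: "t \<in> M s"
    using assms(2,3) unfolding mdom_def by blast
  obtain r where r: "f s = ereal r" using cantideriv_finite[OF assms(1) t] .
  \<comment> \<open>The subgradient inequality at \<open>(s, t)\<close> bounds all members from below by one finite function.\<close>
  have "ereal (r + c x t - c s t) \<le> ?a x" for x
    unfolding lower_env_def
  proof (rule INF_greatest)
    fix h assume h: "h \<in> ?A"
    then have "h s = ereal r" using s r unfolding antiderivs_def by auto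
    then show "ereal (r + c x t - c s t) \<le> h x"
      using h cantideriv_ineq[of c M h t s x] t unfolding antiderivs_def
      by (cases "h x") auto
  qed
  then have "no_minf ?a" unfolding no_minf_def
    by (metis MInfty_neq_ereal(1) ereal_infty_less_eq(2))
  moreover have "?a s < \<infinity>" using lower_env_eq_on[OF ne s] r by simp
  ultimately have pr: "proper ?a" unfolding proper_def by blast
  have anti: "cantideriv c M ?a"
  proof (rule cantiderivI[OF pr])
    fix x y x' assume y: "y \<in> M x"
    have "?a x + ereal (c x' y) - ereal (c x y) \<le> ?a x'"
      unfolding lower_env_def[of c f S M x']
    proof (rule INF_greatest)
      fix h assume h: "h \<in> ?A"
      have "?a x + ereal (c x' y) \<le> h x + ereal (c x' y)"
        using le_funD[OF lower_env_le[OF h]] by (rule add_right_mono)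
      also have "\<dots> \<le> h x' + ereal (c x y)"
        using h y cantideriv_ineq unfolding antiderivs_def by fastforce
      finally show "?a x + ereal (c x' y) - ereal (c x y) \<le> h x'"
        by (simp add: ereal_minus_le)
    qed
    then show "?a x + ereal (c x' y) \<le> ?a x' + ereal (c x y)"
      by (simp add: ereal_minus_le)
  qed
  have eq: "\<forall>x\<in>S. ?a x = f x" using lower_env_eq_on[OF ne] by blast
  have mem: "ctrans (swap_cost c) (ctrans c ?a) \<in> ?A"
    by (rule bitransform_mem_antiderivs[OF assms anti eq])
  \<comment> \<open>Minimality of \<open>\<alpha>\<close> against its own double transform yields \<open>c\<close>-convexity.\<close>
  have "ctrans (swap_cost c) (ctrans c ?a) = ?a"
    by (rule antisym[OF ctrans_ctrans_le lower_env_le[OF mem]])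
  then show ?thesis using mem by simp
qed

lemma upper_env_mem:
  assumes "cantideriv c M f" and "S \<noteq> {}" and "S \<subseteq> mdom M"
  shows "upper_env c f S M \<in> antiderivs c f S M"
proof -
  let ?A = "antiderivs c f S M" and ?u = "upper_env c f S M"
  have ne: "?A \<noteq> {}" using antiderivs_nonempty[OF assms] .
  then obtain h0 where h0: "h0 \<in> ?A" by blast
  obtain s t where s: "s \<in> S" and t: "t \<in> M s"
    using assms(2,3) unfolding mdom_def by blast
  obtain r where r: "f s = ereal r" using cantideriv_finite[OF assms(1) t] .
  have us: "?u s < \<infinity>" using upper_env_eq_on[OF ne s] r by simp
  have "no_minf h0" using h0 unfolding antiderivs_def cconvex_def proper_def by blast
  then have "no_minf ?u"
    using le_funD[OF upper_env_ge[OF h0]] unfolding no_minf_def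
    by (metis ereal_infty_less_eq(2))
  then have pr: "proper ?u" using us unfolding proper_def by blast
  have "cantideriv c M ?u"
  proof (rule cantiderivI[OF pr])
    fix x y x' assume y: "y \<in> M x"
    have "?u x \<le> ?u x' + ereal (c x y) - ereal (c x' y)"
      unfolding upper_env_def[of c f S M x]
    proof (rule SUP_least)
      fix h assume h: "h \<in> ?A"
      have "h x + ereal (c x' y) \<le> h x' + ereal (c x y)"
        using h y cantideriv_ineq unfolding antiderivs_def by fastforce
      also have "\<dots> \<le> ?u x' + ereal (c x y)"
        using le_funD[OF upper_env_ge[OF h]] by (rule add_right_mono)
      finally show "h x \<le> ?u x' + ereal (c x y) - ereal (c x' y)"
        by (simp add: ereal_le_minus)
    qed
    then show "?u x + ereal (c x' y) \<le> ?u x' + ereal (c x y)"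
      by (simp add: ereal_le_minus)
  qed
  moreover have "cconvex c ?u"
  proof -
    \<comment> \<open>Each member is the double transform of itself, hence lies below that of \<open>?u\<close>.\<close>
    have "h \<le> ctrans (swap_cost c) (ctrans c ?u)" if "h \<in> ?A" for h
      using cconvex_bitransform[of c h] that
        ctrans_antimono[OF ctrans_antimono[OF upper_env_ge[OF that]], of "swap_cost c" c]
      unfolding antiderivs_def by auto
    then have "?u \<le> ctrans (swap_cost c) (ctrans c ?u)"
      unfolding upper_env_def le_fun_def by (auto intro!: SUP_least)
    then have "?u = ctrans (swap_cost c) (ctrans c ?u)"
      using ctrans_ctrans_le[of c ?u] by (rule antisym)
    then show ?thesis using pr no_minf_ctrans[OF pr] unfolding cconvex_def by blast
  qed
  ultimately show ?thesis using upper_env_eq_on[OF ne] unfolding antiderivs_def by blast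
qed

section \<open>Duality of the envelopes\<close>

lemma ctrans_lower_env:
  assumes "cantideriv c M f" and "S \<noteq> {}" and "S \<subseteq> mdom M"
  shows "ctrans c (lower_env c f S M)
    = upper_env (swap_cost c) (ctrans c f) (mimage M S) (minv M)"
proof (rule antisym)
  show "ctrans c (lower_env c f S M)
    \<le> upper_env (swap_cost c) (ctrans c f) (mimage M S) (minv M)"
    using upper_env_ge[OF ctrans_mem_antiderivs[OF assms]] lower_env_mem[OF assms]
    unfolding antiderivs_def by blast
  have "k \<le> ctrans c (lower_env c f S M)"
    if "k \<in> antiderivs (swap_cost c) (ctrans c f) (mimage M S) (minv M)" for k
    using ctrans_antimono[OF lower_env_le[OF ctrans_mem_antiderivs_back[OF assms that]], of c]
      cconvex_bitransform[of "swap_cost c" k] that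
    unfolding antiderivs_def by auto
  then show "upper_env (swap_cost c) (ctrans c f) (mimage M S) (minv M)
    \<le> ctrans c (lower_env c f S M)"
    unfolding upper_env_def[of "swap_cost c"] le_fun_def by (auto intro!: SUP_least)
qed

lemma ctrans_upper_env:
  assumes "cantideriv c M f" and "S \<noteq> {}" and "S \<subseteq> mdom M"
  shows "ctrans c (upper_env c f S M)
    = lower_env (swap_cost c) (ctrans c f) (mimage M S) (minv M)"
proof (rule antisym)
  show "lower_env (swap_cost c) (ctrans c f) (mimage M S) (minv M)
    \<le> ctrans c (upper_env c f S M)"
    using lower_env_le[OF ctrans_mem_antiderivs[OF assms]] upper_env_mem[OF assms]
    unfolding antiderivs_def by blast
  have "ctrans c (upper_env c f S M) \<le> k"
    if "k \<in> antiderivs (swap_cost c) (ctrans c f) (mimage M S) (minv M)" for k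
    using ctrans_antimono[OF upper_env_ge[OF ctrans_mem_antiderivs_back[OF assms that]], of c]
      cconvex_bitransform[of "swap_cost c" k] that
    unfolding antiderivs_def by auto
  then show "ctrans c (upper_env c f S M)
    \<le> lower_env (swap_cost c) (ctrans c f) (mimage M S) (minv M)"
    unfolding lower_env_def[of "swap_cost c"] le_fun_def by (auto intro!: INF_greatest)
qed

section \<open>Prescribed values on the whole domain\<close>

lemma upper_env_mdom:
  assumes "cantideriv c M f" and "mdom M \<noteq> {}"
  shows "upper_env c f (mdom M) M
    = ctrans (swap_cost c) (ctrans c (\<lambda>x. f x + iota (mdom M) x))"
proof (rule antisym)
  let ?F = "\<lambda>x. f x + iota (mdom M) x"
  have nf: "f x \<noteq> -\<infinity>" for x
    using assms(1) unfolding cantideriv_def proper_def no_minf_def by blast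
  have on: "?F x = f x" if "x \<in> mdom M" for x using that by (simp add: iota_def)
  have off: "?F x = \<infinity>" if "x \<notin> mdom M" for x
    using that nf[of x] by (simp add: iota_def)
  have ge: "f x \<le> ?F x" for x by (cases "f x") (auto simp: iota_def)
  obtain s t where s: "s \<in> mdom M" "t \<in> M s"
    using assms(2) unfolding mdom_def by blast
  obtain r where r: "f s = ereal r" using cantideriv_finite[OF assms(1) s(2)] .
  have "?F s < \<infinity>" using on[OF s(1)] r by simp
  moreover have "no_minf ?F" using ge nf unfolding no_minf_def by (metis ereal_infty_less_eq(2))
  ultimately have pr: "proper ?F" unfolding proper_def by blast
  have "cantideriv c M ?F"
  proof (rule cantiderivI[OF pr])
    fix x y x' assume y: "y \<in> M x"
    then have "x \<in> mdom M" unfolding mdom_def by blast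
    then have "?F x + ereal (c x' y) = f x + ereal (c x' y)" by (simp add: on)
    also have "\<dots> \<le> f x' + ereal (c x y)" by (rule cantideriv_ineq[OF assms(1) y])
    also have "\<dots> \<le> ?F x' + ereal (c x y)" using ge by (rule add_right_mono)
    finally show "?F x + ereal (c x' y) \<le> ?F x' + ereal (c x y)" .
  qed
  then show "ctrans (swap_cost c) (ctrans c ?F) \<le> upper_env c f (mdom M) M"
    using on by (intro upper_env_ge bitransform_mem_antiderivs[OF assms(1,2)]) auto
  have u: "upper_env c f (mdom M) M \<in> antiderivs c f (mdom M) M"
    by (rule upper_env_mem[OF assms subset_refl])
  then have "upper_env c f (mdom M) M x \<le> ?F x" for x
    using off[of x] unfolding antiderivs_def by (cases "x \<in> mdom M") (auto simp: on)
  then have "upper_env c f (mdom M) M \<le> ?F" by (rule le_funI)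
  then have "ctrans (swap_cost c) (ctrans c (upper_env c f (mdom M) M))
      \<le> ctrans (swap_cost c) (ctrans c ?F)"
    by (intro ctrans_antimono)
  then show "upper_env c f (mdom M) M \<le> ctrans (swap_cost c) (ctrans c ?F)"
    using cconvex_bitransform[of c "upper_env c f (mdom M) M"] u
    unfolding antiderivs_def by simp
qed

text \<open>With \<open>k = f\<^sup>c + \<iota>\<close>, duality of the envelopes and the preceding lemma for \<open>f\<^sup>c\<close> give
  \<open>\<alpha>\<^sup>c = k\<^sup>c\<^sup>c\<close>, whence \<open>\<alpha> = \<alpha>\<^sup>c\<^sup>c = k\<^sup>c\<^sup>c\<^sup>c = k\<^sup>c\<close>.\<close>

lemma lower_env_mdom:
  assumes "cantideriv c M f" and "mdom M \<noteq> {}"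
  shows "lower_env c f (mdom M) M
    = ctrans (swap_cost c) (\<lambda>y. ctrans c f y + iota (mimage M UNIV) y)"
proof -
  let ?a = "lower_env c f (mdom M) M" and ?k = "\<lambda>y. ctrans c f y + iota (mimage M UNIV) y"
  have ne: "mdom (minv M) \<noteq> {}"
    using mimage_ne[OF assms(2) subset_refl] by (simp add: mdom_minv mimage_mdom)
  have "cconvex c ?a"
    using lower_env_mem[OF assms subset_refl] unfolding antiderivs_def by blast
  then have "?a = ctrans (swap_cost c) (ctrans c ?a)" by (simp add: cconvex_bitransform)
  also have "ctrans c ?a = ctrans c (ctrans (swap_cost c) ?k)"
    using ctrans_lower_env[OF assms subset_refl]
      upper_env_mdom[OF cantideriv_ctrans[OF assms] ne]
    by (simp add: mdom_minv mimage_mdom)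
  also have "ctrans (swap_cost c) (ctrans c (ctrans (swap_cost c) ?k))
      = ctrans (swap_cost c) ?k"
    using ctrans_triple[of "swap_cost c"] by simp
  finally show ?thesis .
qed

text \<open>Points outside the image contribute \<open>-\<infinity>\<close> to the supremum; at \<open>t \<in> M s\<close>
  one has \<open>f\<^sup>c t = c s t - f s\<close>, for any such \<open>s\<close>.\<close>

lemma ctrans_restricted_eq_SUP:
  assumes "cantideriv c M f"
  shows "ctrans (swap_cost c) (\<lambda>y. ctrans c f y + iota (mimage M UNIV) y) x
    = (SUP (s, t)\<in>graph M. f s + ereal (c x t) - ereal (c s t))"
proof -
  have val: "f s + ereal (c x t) - ereal (c s t)
      = ereal (c x t) - (ctrans c f t + iota (mimage M UNIV) t)" if t: "t \<in> M s" for s t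
  proof -
    obtain r where "f s = ereal r" "ctrans c f t = ereal (c s t - r)"
      using cantideriv_finite[OF assms t] .
    moreover have "t \<in> mimage M UNIV" using t unfolding mimage_def by blast
    ultimately show ?thesis by (simp add: iota_def)
  qed
  show ?thesis
  proof (rule antisym)
    show "ctrans (swap_cost c) (\<lambda>y. ctrans c f y + iota (mimage M UNIV) y) x
        \<le> (SUP (s, t)\<in>graph M. f s + ereal (c x t) - ereal (c s t))"
      unfolding ctrans_le_iff
    proof
      fix t
      show "ereal (c x t) - (ctrans c f t + iota (mimage M UNIV) t)
        \<le> (SUP (s, t)\<in>graph M. f s + ereal (c x t) - ereal (c s t))"
      proof (cases "t \<in> mimage M UNIV")
        case True
        then obtain s where s: "t \<in> M s" unfolding mimage_def by blast
        then have "(s, t) \<in> graph M" unfolding graph_def by simp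
        then show ?thesis unfolding val[OF s, symmetric]
          by (rule SUP_upper2) simp
      next
        case False
        have "proper f" using assms unfolding cantideriv_def by blast
        then have "ctrans c f t \<noteq> -\<infinity>"
          using no_minf_ctrans[of f c] unfolding no_minf_def by blast
        then show ?thesis using False by (simp add: iota_def)
      qed
    qed
    show "(SUP (s, t)\<in>graph M. f s + ereal (c x t) - ereal (c s t))
        \<le> ctrans (swap_cost c) (\<lambda>y. ctrans c f y + iota (mimage M UNIV) y) x"
    proof (rule SUP_least, clarify)
      fix s t assume "(s, t) \<in> graph M"
      then have t: "t \<in> M s" unfolding graph_def by simp
      show "f s + ereal (c x t) - ereal (c s t)
        \<le> ctrans (swap_cost c) (\<lambda>y. ctrans c f y + iota (mimage M UNIV) y) x"
        unfolding val[OF t] by (rule ctrans_upper)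
    qed
  qed
qed

text \<open>Both envelopes equal \<open>f\<close> on the domain of \<open>M\<close>. A function between them therefore inherits the
  subgradient inequality from the lower one: it has the same value at the base point and is
  larger everywhere else.\<close>

lemma mem_antiderivs_mdom_iff:
  assumes "cantideriv c M f" and "mdom M \<noteq> {}" and "cconvex c h"
  shows "h \<in> antiderivs c f (mdom M) M \<longleftrightarrow>
    lower_env c f (mdom M) M \<le> h \<and> h \<le> upper_env c f (mdom M) M"
proof
  assume "h \<in> antiderivs c f (mdom M) M"
  then show "lower_env c f (mdom M) M \<le> h \<and> h \<le> upper_env c f (mdom M) M"
    using lower_env_le upper_env_ge by blast
next
  let ?a = "lower_env c f (mdom M) M"
  assume between: "?a \<le> h \<and> h \<le> upper_env c f (mdom M) M"
  have ne: "antiderivs c f (mdom M) M \<noteq> {}"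
    by (rule antiderivs_nonempty[OF assms(1,2) subset_refl])
  have eq: "h x = f x" if "x \<in> mdom M" for x
  proof (rule antisym)
    show "h x \<le> f x"
      using between upper_env_eq_on[OF ne that] by (metis le_funD)
    show "f x \<le> h x"
      using between lower_env_eq_on[OF ne that] by (metis le_funD)
  qed
  have a: "cantideriv c M ?a"
    using lower_env_mem[OF assms(1,2) subset_refl] unfolding antiderivs_def by blast
  have pr: "proper h" using assms(3) unfolding cconvex_def by blast
  have "cantideriv c M h"
  proof (rule cantiderivI[OF pr])
    fix x y x' assume y: "y \<in> M x"
    then have x: "x \<in> mdom M" unfolding mdom_def by blast
    have "h x + ereal (c x' y) = ?a x + ereal (c x' y)"
      using eq[OF x] lower_env_eq_on[OF ne x] by simp
    also have "\<dots> \<le> ?a x' + ereal (c x y)" by (rule cantideriv_ineq[OF a y])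
    also have "\<dots> \<le> h x' + ereal (c x y)"
      using between by (intro add_right_mono) (simp add: le_funD)
    finally show "h x + ereal (c x' y) \<le> h x' + ereal (c x y)" .
  qed
  then show "h \<in> antiderivs c f (mdom M) M"
    using assms(3) eq unfolding antiderivs_def by blast
qed

section \<open>Envelopes of constrained antiderivatives\<close>

theorem theorem3p2:
  fixes c :: "'a \<Rightarrow> 'b \<Rightarrow> real" and f :: "'a \<Rightarrow> ereal"
    and M :: "'a \<Rightarrow> 'b set" and S :: "'a set"
  assumes "cantideriv c M f" and "S \<noteq> {}" and "S \<subseteq> mdom M"
  shows
    "(antiderivs c f S M \<noteq> {}
        \<and> upper_env c f S M \<in> antiderivs c f S M
        \<and> lower_env c f S M \<in> antiderivs c f S M)
     \<and> (\<forall>h. cantideriv c M h \<and> (\<forall>x\<in>S. h x = f x) \<longrightarrow>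
          lower_env c f S M \<le> h
          \<and> ctrans c h \<in> antiderivs (swap_cost c) (ctrans c f) (mimage M S) (minv M))
     \<and> (\<forall>h. cconvex c h \<longrightarrow>
          (h \<in> antiderivs c f S M \<longleftrightarrow>
           ctrans c h \<in> antiderivs (swap_cost c) (ctrans c f) (mimage M S) (minv M)))
     \<and> (ctrans c (lower_env c f S M)
          = upper_env (swap_cost c) (ctrans c f) (mimage M S) (minv M)
        \<and> ctrans c (upper_env c f S M)
          = lower_env (swap_cost c) (ctrans c f) (mimage M S) (minv M))
     \<and> (S = mdom M \<longrightarrow>
          upper_env c f (mdom M) M
            = ctrans (swap_cost c) (ctrans c (\<lambda>x. f x + iota (mdom M) x))
          \<and> (\<forall>x. lower_env c f (mdom M) M x
                = ctrans (swap_cost c) (\<lambda>y. ctrans c f y + iota (mimage M UNIV) y) x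
              \<and> ctrans (swap_cost c) (\<lambda>y. ctrans c f y + iota (mimage M UNIV) y) x
                = (SUP (s, t)\<in>graph M. f s + ereal (c x t) - ereal (c s t)))
          \<and> (\<forall>h. cconvex c h \<longrightarrow>
               (h \<in> antiderivs c f (mdom M) M \<longleftrightarrow>
                lower_env c f (mdom M) M \<le> h \<and> h \<le> upper_env c f (mdom M) M)))"
proof -
  have ne: "mdom M \<noteq> {}" using assms(2,3) by blast
  have fwd: "ctrans c h \<in> antiderivs (swap_cost c) (ctrans c f) (mimage M S) (minv M)"
    if "h \<in> antiderivs c f S M" for h
    using ctrans_mem_antiderivs[OF assms] that unfolding antiderivs_def by blast
  show ?thesis
  proof (intro conjI allI impI)
    show "antiderivs c f S M \<noteq> {}" by (rule antiderivs_nonempty[OF assms])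
    show "upper_env c f S M \<in> antiderivs c f S M" by (rule upper_env_mem[OF assms])
    show "lower_env c f S M \<in> antiderivs c f S M" by (rule lower_env_mem[OF assms])
  next
    fix h assume h: "cantideriv c M h \<and> (\<forall>x\<in>S. h x = f x)"
    then show "lower_env c f S M \<le> h" using lower_env_le_antideriv[OF assms] by blast
    show "ctrans c h \<in> antiderivs (swap_cost c) (ctrans c f) (mimage M S) (minv M)"
      using ctrans_mem_antiderivs[OF assms] h by blast
  next
    fix h assume "cconvex c h"
    then show "h \<in> antiderivs c f S M \<longleftrightarrow>
        ctrans c h \<in> antiderivs (swap_cost c) (ctrans c f) (mimage M S) (minv M)"
      using fwd mem_antiderivs_if_ctrans_mem[OF assms] by blast
  next
    show "ctrans c (lower_env c f S M)
        = upper_env (swap_cost c) (ctrans c f) (mimage M S) (minv M)"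
      by (rule ctrans_lower_env[OF assms])
    show "ctrans c (upper_env c f S M)
        = lower_env (swap_cost c) (ctrans c f) (mimage M S) (minv M)"
      by (rule ctrans_upper_env[OF assms])
  next
    show "upper_env c f (mdom M) M
        = ctrans (swap_cost c) (ctrans c (\<lambda>x. f x + iota (mdom M) x))"
      by (rule upper_env_mdom[OF assms(1) ne])
  next
    fix x
    show "lower_env c f (mdom M) M x
        = ctrans (swap_cost c) (\<lambda>y. ctrans c f y + iota (mimage M UNIV) y) x"
      using lower_env_mdom[OF assms(1) ne] by (rule fun_cong)
    show "ctrans (swap_cost c) (\<lambda>y. ctrans c f y + iota (mimage M UNIV) y) x
        = (SUP (s, t)\<in>graph M. f s + ereal (c x t) - ereal (c s t))"
      by (rule ctrans_restricted_eq_SUP[OF assms(1)])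
  next
    fix h assume "cconvex c h"
    then show "h \<in> antiderivs c f (mdom M) M \<longleftrightarrow>
        lower_env c f (mdom M) M \<le> h \<and> h \<le> upper_env c f (mdom M) M"
      by (rule mem_antiderivs_mdom_iff[OF assms(1) ne])
  qed
qed

end
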